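(* Let $a_n,b_n,c_n:\mathbb{R}\to\mathbb{C}$ ($n\in\mathbb{N}$) be differentiable functions of $t\in\mathbb{R}$ such that there exists $K\in\mathbb{R}_+$ with $\max\{|a_n(t)|,|b_n(t)|,|c_n(t)|\}\le K$ for all $n\in\mathbb{N}$, $t\in\mathbb{R}$, and $c_n(t)\ne0$ for all $n\in\mathbb{N}$, $t\in\mathbb{R}$. If $\{a_n,b_n,c_n\}_{n\in\mathbb{N}}$ is a solution of $$\dot a_n=b_n-b_{n-1},\qquad \dot b_n=b_n(a_{n+1}-a_n)+c_n-c_{n-1},\qquad \dot c_n=c_n(a_{n+2}-a_n),\qquad n\in\mathbb{N},$$ with $b_0\equiv0$, $c_0\equiv0$, then for all $t\in\mathbb{R}$ and all $z\in\mathbb{C}$ with $|z|>\|J(t)\|$ and $|z|>\|J(0)\|$, $$\mathcal{R}_J(z)=\exp(zt)\,C_0\,M(t,z)\,(N(t))^{-1},$$ where $$N(t)=\begin{pmatrix}\exp\left(\int_0^t a_1\,ds\right)&\exp\left(\int_0^t a_1\,ds\right)\int_0^t\exp\left(\int_0^s(a_2-a_1)\,dr\right)ds\\ 0&\exp\left(\int_0^t a_2\,ds\right)\end{pmatrix},$$ $$M(t,z)=-\int_0^t\exp(-zs)\,C_0^{-1}N(s)\,ds+(C_0(0))^{-1}\mathcal{R}_0(z).$$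
   Context: $\mathbb{N}=\{1,2,\dots\}$. The dot denotes differentiation with respect to $t\in\mathbb{R}$; dependence on $t$ is often suppressed. $J=J(t)$ is the infinite matrix (indices $1,2,\dots$) with $J_{n,n}=a_n$, $J_{n,n+1}=1$, $J_{n+1,n}=b_n$, $J_{n+2,n}=c_n$ for $n\in\mathbb{N}$ and all other entries zero, identified with a bounded operator on $\ell^2$ with operator norm $\|J(t)\|$. For $|z|>\|J(t)\|$, $\mathcal{R}_J(z)$ is the upper left $2\times2$ block of the resolvent $(zI-J(t))^{-1}=\sum_{n\ge0}J(t)^n/z^{n+1}$; $\mathcal{R}_0(z)$ denotes $\mathcal{R}_J(z)$ for $t=0$. $C_0=C_0(t)=\begin{pmatrix}1&0\\-a_1(t)&1\end{pmatrix}$, and $C_0(0)$ is its value at $t=0$; inside the integral defining $M(t,z)$, $C_0^{-1}$ is evaluated at $s$. $\int_0^tf(s)\,ds$ denotes the solution $X$ of $\dot X=f(t)$, $X(0)=0$. *)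

theory Defs
  imports "HOL-Analysis.Analysis"
begin

text \<open>
  Everything is indexed by 1, 2, \dots, so a vector of the sequence space is represented by a
  function on \<^typ>\<open>nat\<close> whose (meaningless) value at index 0 is fixed to be 0.
\<close>

typedef ell2 = "{x :: nat \<Rightarrow> complex. x 0 = 0 \<and> summable (\<lambda>n. (cmod (x n))\<^sup>2)}"
  morphisms ell2_nth Abs_ell2
  by (rule exI[of _ "\<lambda>_. 0"]) simp

setup_lifting type_definition_ell2

lemma ell2_nth_0 [simp]: "ell2_nth x 0 = 0"
  using ell2_nth[of x] by simp

lemma summable_ell2: "summable (\<lambda>n. (cmod (ell2_nth x n))\<^sup>2)"
  using ell2_nth[of x] by simp

lemma ell2_eqI: "(\<And>n. ell2_nth x n = ell2_nth y n) \<Longrightarrow> x = y"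
  by (simp add: ell2_nth_inject[symmetric] fun_eq_iff)

lemma square_add_le: "(a + b)\<^sup>2 \<le> 2 * a\<^sup>2 + 2 * (b::real)\<^sup>2"
  using sum_squares_bound[of a b] by (simp add: power2_sum)

lemma summable_square_add:
  fixes f g :: "nat \<Rightarrow> complex"
  assumes "summable (\<lambda>n. (cmod (f n))\<^sup>2)" "summable (\<lambda>n. (cmod (g n))\<^sup>2)"
  shows "summable (\<lambda>n. (cmod (f n + g n))\<^sup>2)"
proof (rule summable_comparison_test')
  show "summable (\<lambda>n. 2 * (cmod (f n))\<^sup>2 + 2 * (cmod (g n))\<^sup>2)"
    by (intro summable_add summable_mult assms)
  show "norm ((cmod (f n + g n))\<^sup>2) \<le> 2 * (cmod (f n))\<^sup>2 + 2 * (cmod (g n))\<^sup>2" if "n \<ge> 0" for n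
  proof -
    have "(cmod (f n + g n))\<^sup>2 \<le> (cmod (f n) + cmod (g n))\<^sup>2"
      by (intro power_mono norm_triangle_ineq) simp
    also have "\<dots> \<le> 2 * (cmod (f n))\<^sup>2 + 2 * (cmod (g n))\<^sup>2"
      by (rule square_add_le)
    finally show ?thesis by simp
  qed
qed

lemma summable_square_mult:
  fixes f :: "nat \<Rightarrow> complex"
  assumes "summable (\<lambda>n. (cmod (f n))\<^sup>2)"
  shows "summable (\<lambda>n. (cmod (c * f n))\<^sup>2)"
  using summable_mult[OF assms, of "(cmod c)\<^sup>2"] by (simp add: norm_mult power_mult_distrib)

lift_definition scaleC_ell2 :: "complex \<Rightarrow> ell2 \<Rightarrow> ell2" (infixr \<open>*\<^sub>C\<close> 75)
  is "\<lambda>c x n. c * x n"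
  using summable_square_mult by auto

instantiation ell2 :: real_vector
begin

lift_definition zero_ell2 :: ell2 is "\<lambda>_. 0"
  by simp

lift_definition plus_ell2 :: "ell2 \<Rightarrow> ell2 \<Rightarrow> ell2" is "\<lambda>x y n. x n + y n"
  using summable_square_add by auto

lift_definition uminus_ell2 :: "ell2 \<Rightarrow> ell2" is "\<lambda>x n. - x n"
  by simp

definition minus_ell2 :: "ell2 \<Rightarrow> ell2 \<Rightarrow> ell2"
  where "minus_ell2 x y = x + - y"

definition scaleR_ell2 :: "real \<Rightarrow> ell2 \<Rightarrow> ell2"
  where "scaleR_ell2 r x = of_real r *\<^sub>C x"

instance
proof
  fix x y z :: ell2 and r s :: real
  show "x + y + z = x + (y + z)" by transfer (simp add: add.assoc)
  show "x + y = y + x" by transfer (simp add: add.commute)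
  show "0 + x = x" by transfer simp
  show "- x + x = 0" by transfer simp
  show "x - y = x + - y" by (rule minus_ell2_def)
  show "r *\<^sub>R (x + y) = r *\<^sub>R x + r *\<^sub>R y"
    unfolding scaleR_ell2_def by transfer (simp add: algebra_simps)
  show "(r + s) *\<^sub>R x = r *\<^sub>R x + s *\<^sub>R x"
    unfolding scaleR_ell2_def by transfer (simp add: algebra_simps)
  show "r *\<^sub>R s *\<^sub>R x = (r * s) *\<^sub>R x"
    unfolding scaleR_ell2_def by transfer (simp add: algebra_simps)
  show "1 *\<^sub>R x = x"
    unfolding scaleR_ell2_def by transfer simp
qed

end

lemma ell2_nth_simps [simp]:
  "ell2_nth 0 n = 0"
  "ell2_nth (x + y) n = ell2_nth x n + ell2_nth y n"
  "ell2_nth (- x) n = - ell2_nth x n"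
  "ell2_nth (x - y) n = ell2_nth x n - ell2_nth y n"
  "ell2_nth (c *\<^sub>C x) n = c * ell2_nth x n"
  "ell2_nth (r *\<^sub>R x) n = r *\<^sub>R ell2_nth x n"
proof -
  show "ell2_nth (x - y) n = ell2_nth x n - ell2_nth y n"
    unfolding minus_ell2_def plus_ell2.rep_eq uminus_ell2.rep_eq by (rule add_uminus_conv_diff)
qed (simp_all add: zero_ell2.rep_eq plus_ell2.rep_eq uminus_ell2.rep_eq
      scaleC_ell2.rep_eq scaleR_ell2_def scaleR_conv_of_real)

lemma summable_inner_ell2: "summable (\<lambda>n. ell2_nth x n \<bullet> ell2_nth y n)"
proof (rule summable_comparison_test')
  show "summable (\<lambda>n. (cmod (ell2_nth x n))\<^sup>2 + (cmod (ell2_nth y n))\<^sup>2)"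
    by (intro summable_add summable_ell2)
  show "norm (ell2_nth x n \<bullet> ell2_nth y n) \<le> (cmod (ell2_nth x n))\<^sup>2 + (cmod (ell2_nth y n))\<^sup>2"
    if "n \<ge> 0" for n
  proof -
    have "\<bar>ell2_nth x n \<bullet> ell2_nth y n\<bar> \<le> cmod (ell2_nth x n) * cmod (ell2_nth y n)"
      by (rule Cauchy_Schwarz_ineq2)
    moreover have "2 * cmod (ell2_nth x n) * cmod (ell2_nth y n)
        \<le> (cmod (ell2_nth x n))\<^sup>2 + (cmod (ell2_nth y n))\<^sup>2"
      by (rule sum_squares_bound)
    moreover have "0 \<le> cmod (ell2_nth x n) * cmod (ell2_nth y n)"
      by simp
    ultimately show ?thesis by (simp only: real_norm_def)
  qed
qed

text \<open>
  The real inner product below is the real part of the usual sesquilinear one, with the same norm.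
\<close>

instantiation ell2 :: real_inner
begin

definition norm_ell2 :: "ell2 \<Rightarrow> real"
  where "norm_ell2 x = sqrt (\<Sum>n. (cmod (ell2_nth x n))\<^sup>2)"

definition inner_ell2 :: "ell2 \<Rightarrow> ell2 \<Rightarrow> real"
  where "inner_ell2 x y = (\<Sum>n. ell2_nth x n \<bullet> ell2_nth y n)"

definition dist_ell2 :: "ell2 \<Rightarrow> ell2 \<Rightarrow> real"
  where "dist_ell2 x y = norm (x - y)"

definition sgn_ell2 :: "ell2 \<Rightarrow> ell2"
  where "sgn_ell2 x = inverse (norm x) *\<^sub>R x"

definition uniformity_ell2 :: "(ell2 \<times> ell2) filter"
  where "uniformity_ell2 = (INF e\<in>{0<..}. principal {(x, y). dist x y < e})"

definition open_ell2 :: "ell2 set \<Rightarrow> bool"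
  where "open_ell2 U = (\<forall>x\<in>U. \<forall>\<^sub>F (x', y) in uniformity. x' = x \<longrightarrow> y \<in> U)"

instance
proof
  fix x y z :: ell2 and r :: real and U :: "ell2 set"
  show "dist x y = norm (x - y)" by (rule dist_ell2_def)
  show "sgn x = x /\<^sub>R norm x" by (rule sgn_ell2_def)
  show "uniformity = (INF e\<in>{0<..}. principal {(x, y :: ell2). dist x y < e})"
    by (rule uniformity_ell2_def)
  show "open U = (\<forall>x\<in>U. \<forall>\<^sub>F (x', y) in uniformity. x' = x \<longrightarrow> y \<in> U)"
    by (rule open_ell2_def)
  show "x \<bullet> y = y \<bullet> x"
    by (simp add: inner_ell2_def inner_commute)
  show "(x + y) \<bullet> z = x \<bullet> z + y \<bullet> z"
    by (simp add: inner_ell2_def inner_add_left suminf_add summable_inner_ell2)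
  show "r *\<^sub>R x \<bullet> y = r * (x \<bullet> y)"
    by (simp add: inner_ell2_def suminf_mult summable_inner_ell2)
  show "0 \<le> x \<bullet> x"
    by (simp add: inner_ell2_def suminf_nonneg summable_inner_ell2)
  show "x \<bullet> x = 0 \<longleftrightarrow> x = 0"
  proof
    assume "x \<bullet> x = 0"
    then have "\<forall>n. ell2_nth x n \<bullet> ell2_nth x n = 0"
      using suminf_eq_zero_iff[OF summable_inner_ell2[of x x]] by (simp add: inner_ell2_def)
    then show "x = 0" by (intro ell2_eqI) simp
  qed (simp add: inner_ell2_def)
  show "norm x = sqrt (x \<bullet> x)"
    by (simp add: norm_ell2_def inner_ell2_def dot_square_norm)
qed

end

lemma norm_ell2_square: "(norm x)\<^sup>2 = (\<Sum>n. (cmod (ell2_nth x n))\<^sup>2)" for x :: ell2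
  by (simp add: norm_ell2_def suminf_nonneg summable_ell2)

lemma norm_ell2_nth_le: "cmod (ell2_nth x n) \<le> norm x"
proof -
  have "(cmod (ell2_nth x n))\<^sup>2 = (\<Sum>k\<in>{n}. (cmod (ell2_nth x k))\<^sup>2)" by simp
  also have "\<dots> \<le> (\<Sum>k. (cmod (ell2_nth x k))\<^sup>2)"
    by (intro sum_le_suminf summable_ell2) auto
  finally show ?thesis
    unfolding norm_ell2_square[symmetric] by (rule power2_le_imp_le) simp
qed

lemma bounded_linear_ell2_nth: "bounded_linear (\<lambda>x. ell2_nth x n)"
  by (rule bounded_linear_intro[where K = 1]) (simp_all add: norm_ell2_nth_le)

lemma norm_scaleC_ell2 [simp]: "norm (c *\<^sub>C x) = cmod c * norm x"
proof -
  have "(norm (c *\<^sub>C x))\<^sup>2 = (cmod c * norm x)\<^sup>2"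
    by (simp add: norm_ell2_square norm_mult power_mult_distrib suminf_mult summable_ell2)
  then show ?thesis by (simp add: power2_eq_iff_nonneg)
qed

lemma bounded_linear_scaleC_ell2: "bounded_linear (\<lambda>x. c *\<^sub>C x)"
  by (rule bounded_linear_intro[where K = "cmod c"])
    (auto intro!: ell2_eqI simp: algebra_simps)

instance ell2 :: banach
proof
  fix X :: "nat \<Rightarrow> ell2"
  assume X: "Cauchy X"
  have "Cauchy (\<lambda>k. ell2_nth (X k) n)" for n
    by (rule bounded_linear.Cauchy[OF bounded_linear_ell2_nth X])
  then have "\<exists>l. (\<lambda>k. ell2_nth (X k) n) \<longlonglongrightarrow> l" for n
    unfolding convergent_def[symmetric] by (rule Cauchy_convergent)
  then obtain l where l: "\<And>n. (\<lambda>k. ell2_nth (X k) n) \<longlonglongrightarrow> l n" by metis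
  have l0: "l 0 = 0"
    by (rule LIMSEQ_unique[OF l]) simp
  have fin: "(\<Sum>n<N. (cmod (ell2_nth (X k) n - l n))\<^sup>2) \<le> e\<^sup>2"
    if e: "e > 0" and M: "\<And>m n. m \<ge> M \<Longrightarrow> n \<ge> M \<Longrightarrow> norm (X m - X n) < e" and "k \<ge> M" for e M k N
  proof (rule tendsto_upperbound)
    show "(\<lambda>j. \<Sum>n<N. (cmod (ell2_nth (X k) n - ell2_nth (X j) n))\<^sup>2)
        \<longlonglongrightarrow> (\<Sum>n<N. (cmod (ell2_nth (X k) n - l n))\<^sup>2)"
      by (intro tendsto_intros l)
    show "\<forall>\<^sub>F j in sequentially. (\<Sum>n<N. (cmod (ell2_nth (X k) n - ell2_nth (X j) n))\<^sup>2) \<le> e\<^sup>2"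
      unfolding eventually_sequentially
    proof (intro exI allI impI)
      fix j assume "M \<le> j"
      have "(\<Sum>n<N. (cmod (ell2_nth (X k - X j) n))\<^sup>2) \<le> (norm (X k - X j))\<^sup>2"
        unfolding norm_ell2_square by (intro sum_le_suminf summable_ell2) auto
      also have "\<dots> \<le> e\<^sup>2"
        using M[OF \<open>k \<ge> M\<close> \<open>M \<le> j\<close>] by (intro power_mono) auto
      finally show "(\<Sum>n<N. (cmod (ell2_nth (X k) n - ell2_nth (X j) n))\<^sup>2) \<le> e\<^sup>2" by simp
    qed
  qed simp
  have sm: "summable (\<lambda>n. (cmod (ell2_nth (X k) n - l n))\<^sup>2)"
    if "e > 0" "\<And>m n. m \<ge> M \<Longrightarrow> n \<ge> M \<Longrightarrow> norm (X m - X n) < e" "k \<ge> M" for e M k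
    by (intro summableI_nonneg_bounded[where x = "e\<^sup>2"] fin[OF that]) auto
  obtain M0 where M0: "\<And>m n. m \<ge> M0 \<Longrightarrow> n \<ge> M0 \<Longrightarrow> norm (X m - X n) < 1"
    using CauchyD[OF X zero_less_one] by auto
  have "summable (\<lambda>n. (cmod (ell2_nth (X M0) n - l n))\<^sup>2)"
    by (rule sm[OF zero_less_one M0 order_refl])
  then have "summable (\<lambda>n. (cmod (-1 * (ell2_nth (X M0) n - l n)))\<^sup>2)"
    by (rule summable_square_mult)
  from summable_square_add[OF this summable_ell2[of "X M0"]]
  have "summable (\<lambda>n. (cmod (l n))\<^sup>2)" by simp
  then have L: "ell2_nth (Abs_ell2 l) = l"
    using l0 by (intro Abs_ell2_inverse) simp
  have "X \<longlonglongrightarrow> Abs_ell2 l"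
  proof (rule LIMSEQ_I)
    fix r :: real assume "r > 0"
    then have r: "r / 2 > 0" by simp
    obtain M where M: "\<And>m n. m \<ge> M \<Longrightarrow> n \<ge> M \<Longrightarrow> norm (X m - X n) < r / 2"
      using CauchyD[OF X r] by auto
    have "norm (X k - Abs_ell2 l) < r" if "k \<ge> M" for k
    proof -
      have "(norm (X k - Abs_ell2 l))\<^sup>2 \<le> (r / 2)\<^sup>2"
        unfolding norm_ell2_square ell2_nth_simps L
        by (intro suminf_le_const sm[OF r M that] fin[OF r M that])
      then have "norm (X k - Abs_ell2 l) \<le> r / 2"
        by (rule power2_le_imp_le) (use r in simp)
      then show ?thesis using \<open>r > 0\<close> by simp
    qed
    then show "\<exists>M. \<forall>k\<ge>M. norm (X k - Abs_ell2 l) < r" by blast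
  qed
  then show "convergent X" by (auto simp: convergent_def)
qed

definition unit_ell2 :: "nat \<Rightarrow> ell2"
  where "unit_ell2 j = Abs_ell2 (\<lambda>n. if n = j \<and> j \<noteq> 0 then 1 else 0)"

lemma ell2_nth_unit: "ell2_nth (unit_ell2 j) n = (if n = j \<and> j \<noteq> 0 then 1 else 0)"
proof -
  have "summable (\<lambda>n. (cmod (if n = j \<and> j \<noteq> 0 then 1 else 0))\<^sup>2)"
    by (rule summable_finite[of "{j}"]) auto
  then have "ell2_nth (unit_ell2 j) = (\<lambda>n. if n = j \<and> j \<noteq> 0 then 1 else 0)"
    unfolding unit_ell2_def by (intro Abs_ell2_inverse) auto
  then show ?thesis by simp
qed

text \<open>Row and column 0 are padding, as for vectors.\<close>

definition J_matrix ::
  "(nat \<Rightarrow> complex) \<Rightarrow> (nat \<Rightarrow> complex) \<Rightarrow> (nat \<Rightarrow> complex) \<Rightarrow> nat \<Rightarrow> nat \<Rightarrow> complex"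
  where "J_matrix a b c m n =
    (if m = 0 \<or> n = 0 then 0
     else if m = n then a n
     else if n = m + 1 then 1
     else if m = n + 1 then b n
     else if m = n + 2 then c n
     else 0)"

definition matrix_op :: "(nat \<Rightarrow> nat \<Rightarrow> complex) \<Rightarrow> ell2 \<Rightarrow> ell2"
  where "matrix_op A x = Abs_ell2 (\<lambda>m. \<Sum>n. A m n * ell2_nth x n)"

definition J_op ::
  "(nat \<Rightarrow> real \<Rightarrow> complex) \<Rightarrow> (nat \<Rightarrow> real \<Rightarrow> complex) \<Rightarrow> (nat \<Rightarrow> real \<Rightarrow> complex)
    \<Rightarrow> real \<Rightarrow> ell2 \<Rightarrow> ell2"
  where "J_op a b c t = matrix_op (J_matrix (\<lambda>n. a n t) (\<lambda>n. b n t) (\<lambda>n. c n t))"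

definition resolvent :: "(ell2 \<Rightarrow> ell2) \<Rightarrow> complex \<Rightarrow> ell2 \<Rightarrow> ell2"
  where "resolvent T z = inv (\<lambda>x. z *\<^sub>C x - T x)"

definition upper_left_block :: "(ell2 \<Rightarrow> ell2) \<Rightarrow> complex^2^2"
  where "upper_left_block T =
    vector [vector [ell2_nth (T (unit_ell2 1)) 1, ell2_nth (T (unit_ell2 2)) 1],
            vector [ell2_nth (T (unit_ell2 1)) 2, ell2_nth (T (unit_ell2 2)) 2]]"

definition res_block ::
  "(nat \<Rightarrow> real \<Rightarrow> complex) \<Rightarrow> (nat \<Rightarrow> real \<Rightarrow> complex) \<Rightarrow> (nat \<Rightarrow> real \<Rightarrow> complex)
    \<Rightarrow> real \<Rightarrow> complex \<Rightarrow> complex^2^2"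
  where "res_block a b c t z = upper_left_block (resolvent (J_op a b c t) z)"

text \<open>The oriented integral of \<open>f\<close> from 0 to \<open>t\<close>, for \<open>t\<close> of either sign.\<close>

definition integral0 :: "(real \<Rightarrow> 'a::real_normed_vector) \<Rightarrow> real \<Rightarrow> 'a"
  where "integral0 f =
    (THE X. X 0 = 0 \<and> (\<forall>t. (X has_vector_derivative f t) (at t)))"

definition scaleC_mat :: "complex \<Rightarrow> complex^2^2 \<Rightarrow> complex^2^2" (infixr \<open>*\<^sub>M\<close> 75)
  where "k *\<^sub>M A = map_matrix (\<lambda>u. k * u) A"

definition C0_mat :: "(nat \<Rightarrow> real \<Rightarrow> complex) \<Rightarrow> real \<Rightarrow> complex^2^2"
  where "C0_mat a t = vector [vector [1, 0], vector [- a 1 t, 1]]"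

definition N_mat :: "(nat \<Rightarrow> real \<Rightarrow> complex) \<Rightarrow> real \<Rightarrow> complex^2^2"
  where "N_mat a t =
    vector [vector [exp (integral0 (a 1) t),
                    exp (integral0 (a 1) t) *
                      integral0 (\<lambda>s. exp (integral0 (\<lambda>r. a 2 r - a 1 r) s)) t],
            vector [0, exp (integral0 (a 2) t)]]"

definition M_mat ::
  "(nat \<Rightarrow> real \<Rightarrow> complex) \<Rightarrow> (nat \<Rightarrow> real \<Rightarrow> complex) \<Rightarrow> (nat \<Rightarrow> real \<Rightarrow> complex)
    \<Rightarrow> real \<Rightarrow> complex \<Rightarrow> complex^2^2"
  where "M_mat a b c t z =
    - integral0 (\<lambda>s. exp (- z * of_real s) *\<^sub>M (matrix_inv (C0_mat a s) ** N_mat a s)) t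
    + matrix_inv (C0_mat a 0) ** res_block a b c 0 z"

lemma J_row:
  assumes "m \<noteq> 0"
  shows "(\<Sum>n. J_matrix a b c m n * ell2_nth x n) =
    a m * ell2_nth x m + ell2_nth x (m + 1) + b (m - 1) * ell2_nth x (m - 1)
      + c (m - 2) * ell2_nth x (m - 2)"
proof -
  define F where "F n = (if n = m then a n * ell2_nth x n else 0)
    + (if n = m + 1 then ell2_nth x n else 0)
    + (if n = m - 1 then b n * ell2_nth x n else 0)
    + (if n = m - 2 then c n * ell2_nth x n else 0)" for n
  have "J_matrix a b c m n * ell2_nth x n = F n" for n
    using assms by (cases "n = 0") (auto simp: J_matrix_def F_def)
  then have "(\<Sum>n. J_matrix a b c m n * ell2_nth x n) = (\<Sum>n. F n)" by simp
  also have "\<dots> = (\<Sum>n\<in>{..m+1}. F n)"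
    by (rule suminf_finite) (auto simp: F_def)
  also have "\<dots> = a m * ell2_nth x m + ell2_nth x (m + 1) + b (m - 1) * ell2_nth x (m - 1)
      + c (m - 2) * ell2_nth x (m - 2)"
    by (simp add: F_def sum.distrib del: sum.atMost_Suc)
  finally show ?thesis .
qed

lemma J_matrix_bounded:
  fixes x :: ell2
  assumes K: "\<And>n. n \<ge> 1 \<Longrightarrow> cmod (a n) \<le> K \<and> cmod (b n) \<le> K \<and> cmod (c n) \<le> K"
  defines "y \<equiv> \<lambda>m. \<Sum>n. J_matrix a b c m n * ell2_nth x n"
  shows "y 0 = 0" "summable (\<lambda>m. (cmod (y m))\<^sup>2)"
    "(\<Sum>m. (cmod (y m))\<^sup>2) \<le> (4 * (1 + K) * norm x)\<^sup>2"
proof -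
  show "y 0 = 0" by (simp add: y_def J_matrix_def)
  have K0: "0 \<le> K" by (rule order_trans[OF norm_ge_zero conjunct1[OF K[OF order_refl]]])
  define u where "u m = (cmod (ell2_nth x m))\<^sup>2" for m
  have u: "summable u" and u0: "u m \<ge> 0" and u00: "u 0 = 0" and su: "suminf u = (norm x)\<^sup>2" for m
    using summable_ell2[of x] by (simp_all add: u_def[abs_def] norm_ell2_square)
  have s1: "summable (\<lambda>m. u (m + 1))" "(\<Sum>m. u (m + 1)) = (norm x)\<^sup>2"
    using summable_ignore_initial_segment[OF u, of 1] suminf_split_head[OF u] u00 su by simp_all
  have shift: "summable (\<lambda>m. f (m - 1)) \<and> (\<Sum>m. f (m - 1)) = suminf f"
    if "summable f" "f 0 = 0" for f :: "nat \<Rightarrow> real"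
  proof -
    have "summable (\<lambda>m. f (m - 1))" using that(1) summable_Suc_iff[of "\<lambda>m. f (m - 1)"] by simp
    then show ?thesis using suminf_split_head[of "\<lambda>m. f (m - 1)"] that(2) by simp
  qed
  have s2: "summable (\<lambda>m. u (m - 1))" "(\<Sum>m. u (m - 1)) = (norm x)\<^sup>2"
    using shift[OF u u00] su by auto
  have s3: "summable (\<lambda>m. u (m - 2))" "(\<Sum>m. u (m - 2)) = (norm x)\<^sup>2"
  proof -
    have m: "m - 1 - 1 = m - (2::nat)" for m by simp
    have "summable (\<lambda>m. u (m - 1 - 1)) \<and> (\<Sum>m. u (m - 1 - 1)) = (\<Sum>m. u (m - 1))"
      using shift[of "\<lambda>m. u (m - 1)"] s2(1) u00 by simp
    then show "summable (\<lambda>m. u (m - 2))" "(\<Sum>m. u (m - 2)) = (norm x)\<^sup>2"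
      unfolding m s2(2) by auto
  qed
  define v where "v m = 4 * (1 + K)\<^sup>2 * (u m + u (m + 1) + u (m - 1) + u (m - 2))" for m
  have "v sums (4 * (1 + K)\<^sup>2 * ((norm x)\<^sup>2 + (norm x)\<^sup>2 + (norm x)\<^sup>2 + (norm x)\<^sup>2))"
    unfolding v_def[abs_def] using u su s1 s2 s3
    by (intro sums_mult sums_add) (auto simp: sums_iff)
  then have v: "summable v" "suminf v = 4 * (1 + K)\<^sup>2 * (4 * (norm x)\<^sup>2)"
    by (auto simp: sums_iff)
  have le: "(cmod (y m))\<^sup>2 \<le> v m" for m
  proof (cases "m = 0")
    case True
    then show ?thesis using \<open>y 0 = 0\<close> u0 by (simp add: v_def)
  next
    case False
    define p q r s where "p = cmod (ell2_nth x m)" and "q = cmod (ell2_nth x (m + 1))"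
      and "r = cmod (ell2_nth x (m - 1))" and "s = cmod (ell2_nth x (m - 2))"
    have co: "cmod (w * ell2_nth x n) \<le> (1 + K) * cmod (ell2_nth x n)"
      if "n \<ge> 1 \<Longrightarrow> cmod w \<le> 1 + K" for w n
      using that by (cases "n = 0") (auto simp: norm_mult intro!: mult_right_mono)
    have K': "cmod (a n) \<le> 1 + K" "cmod (b n) \<le> 1 + K" "cmod (c n) \<le> 1 + K" if "n \<ge> 1" for n
      using K[OF that] by auto
    have "cmod (y m) \<le> cmod (a m * ell2_nth x m) + cmod (1 * ell2_nth x (m + 1))
        + cmod (b (m - 1) * ell2_nth x (m - 1)) + cmod (c (m - 2) * ell2_nth x (m - 2))"
      unfolding y_def J_row[OF False] mult_1
      by (intro order_trans[OF norm_triangle_ineq] add_mono order_refl)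
    also have "\<dots> \<le> (1 + K) * p + (1 + K) * q + (1 + K) * r + (1 + K) * s"
      unfolding p_def q_def r_def s_def
      by (intro add_mono co K') (use K0 in auto)
    also have "\<dots> = (1 + K) * ((p + q) + (r + s))" by (simp add: algebra_simps)
    finally have "(cmod (y m))\<^sup>2 \<le> ((1 + K) * ((p + q) + (r + s)))\<^sup>2"
      by (intro power_mono) auto
    also have "\<dots> = (1 + K)\<^sup>2 * ((p + q) + (r + s))\<^sup>2" by (rule power_mult_distrib)
    also have "\<dots> \<le> (1 + K)\<^sup>2 * (4 * (p\<^sup>2 + q\<^sup>2 + r\<^sup>2 + s\<^sup>2))"
      using square_add_le[of "p + q" "r + s"] square_add_le[of p q] square_add_le[of r s]
      by (intro mult_left_mono) auto
    also have "\<dots> = v m"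
      by (simp add: v_def u_def p_def q_def r_def s_def)
    finally show ?thesis .
  qed
  show sy: "summable (\<lambda>m. (cmod (y m))\<^sup>2)"
    by (rule summable_comparison_test'[OF v(1)]) (use le in auto)
  have "(\<Sum>m. (cmod (y m))\<^sup>2) \<le> suminf v"
    by (rule suminf_le[OF le sy v(1)])
  also have "suminf v = (4 * (1 + K) * norm x)\<^sup>2"
    unfolding v(2) by algebra
  finally show "(\<Sum>m. (cmod (y m))\<^sup>2) \<le> (4 * (1 + K) * norm x)\<^sup>2" .
qed

lemma
  assumes K: "\<And>n. n \<ge> 1 \<Longrightarrow> cmod (a n t) \<le> K \<and> cmod (b n t) \<le> K \<and> cmod (c n t) \<le> K"
  shows ell2_nth_J_op: "ell2_nth (J_op a b c t x) m =
      (\<Sum>n. J_matrix (\<lambda>n. a n t) (\<lambda>n. b n t) (\<lambda>n. c n t) m n * ell2_nth x n)"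
    and bounded_linear_J_op: "bounded_linear (J_op a b c t)"
    and J_op_scaleC: "J_op a b c t (w *\<^sub>C x) = w *\<^sub>C J_op a b c t x"
proof -
  note bd = J_matrix_bounded[of "\<lambda>n. a n t" K "\<lambda>n. b n t" "\<lambda>n. c n t"]
  show nth: "ell2_nth (J_op a b c t x) m =
      (\<Sum>n. J_matrix (\<lambda>n. a n t) (\<lambda>n. b n t) (\<lambda>n. c n t) m n * ell2_nth x n)" for x m
  proof -
    have "ell2_nth (J_op a b c t x) =
        (\<lambda>m. \<Sum>n. J_matrix (\<lambda>n. a n t) (\<lambda>n. b n t) (\<lambda>n. c n t) m n * ell2_nth x n)"
      unfolding J_op_def matrix_op_def
      by (intro Abs_ell2_inverse CollectI conjI bd(1) bd(2) K)
    then show ?thesis by simp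
  qed
  have row: "ell2_nth (J_op a b c t x) m = (if m = 0 then 0 else
      a m t * ell2_nth x m + ell2_nth x (m + 1) + b (m - 1) t * ell2_nth x (m - 1)
      + c (m - 2) t * ell2_nth x (m - 2))" for x m
  proof (cases "m = 0")
    case True
    then show ?thesis by simp
  next
    case False
    show ?thesis unfolding nth J_row[OF False] using False by (simp only: if_False)
  qed
  show "J_op a b c t (w *\<^sub>C x) = w *\<^sub>C J_op a b c t x"
    by (intro ell2_eqI) (simp add: row algebra_simps)
  show "bounded_linear (J_op a b c t)"
  proof (rule bounded_linear_intro[where K = "4 * (1 + K)"])
    fix x y :: ell2 and r :: real
    show "J_op a b c t (x + y) = J_op a b c t x + J_op a b c t y"
      by (intro ell2_eqI) (simp add: row algebra_simps)
    show "J_op a b c t (r *\<^sub>R x) = r *\<^sub>R J_op a b c t x"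
      by (intro ell2_eqI) (simp add: row algebra_simps)
    have "0 \<le> K" by (rule order_trans[OF norm_ge_zero conjunct1[OF K[OF order_refl]]])
    then have ge: "0 \<le> 4 * (1 + K) * norm x" by simp
    have "(norm (J_op a b c t x))\<^sup>2 \<le> (4 * (1 + K) * norm x)\<^sup>2"
      unfolding norm_ell2_square[of "J_op a b c t x"] nth by (intro bd(3) K)
    then have "norm (J_op a b c t x) \<le> 4 * (1 + K) * norm x"
      using ge by (rule power2_le_imp_le)
    then show "norm (J_op a b c t x) \<le> norm x * (4 * (1 + K))"
      by (simp only: mult.commute)
  qed
qed

lemma resolvent_sums:
  assumes T: "bounded_linear T" and TC: "\<And>w x. T (w *\<^sub>C x) = w *\<^sub>C T x" and z: "onorm T < cmod z"
  shows "bij (\<lambda>x. z *\<^sub>C x - T x)"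
    and "(\<lambda>n. inverse (z ^ Suc n) *\<^sub>C (T ^^ n) x) sums resolvent T z x"
proof -
  interpret T: bounded_linear T by (rule T)
  define q where "q = onorm T / cmod z"
  have o0: "0 \<le> onorm T" by (rule onorm_pos_le[OF T])
  then have z0: "z \<noteq> 0" "cmod z > 0" using z by auto
  have q: "0 \<le> q" "q < 1" using o0 z z0 by (auto simp: q_def)
  define U where "U x n = inverse (z ^ Suc n) *\<^sub>C (T ^^ n) x" for x n
  have pw: "norm ((T ^^ n) x) \<le> onorm T ^ n * norm x" for n x
  proof (induction n)
    case (Suc n)
    have "norm ((T ^^ Suc n) x) \<le> onorm T * norm ((T ^^ n) x)" using onorm[OF T] by simp
    also have "\<dots> \<le> onorm T * (onorm T ^ n * norm x)" by (intro mult_left_mono Suc o0)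
    finally show ?case by (simp add: mult.assoc)
  qed simp
  have sU: "summable (U x)" for x
  proof (rule summable_comparison_test')
    show "summable (\<lambda>n. norm x / cmod z * q ^ n)"
      using q by (intro summable_mult summable_geometric) auto
    show "norm (U x n) \<le> norm x / cmod z * q ^ n" if "n \<ge> 0" for n
    proof -
      have "norm (U x n) = norm ((T ^^ n) x) / cmod z ^ Suc n"
        by (simp only: U_def norm_scaleC_ell2 norm_inverse norm_power divide_inverse mult.commute)
      also have "\<dots> \<le> (onorm T ^ n * norm x) / cmod z ^ Suc n"
        using z0 by (intro divide_right_mono pw) auto
      also have "\<dots> = norm x / cmod z * q ^ n" by (simp add: q_def power_divide)
      finally show ?thesis .
    qed
  qed
  have right: "z *\<^sub>C suminf (U x) - T (suminf (U x)) = x" for x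
  proof -
    have step: "T (U x n) = z *\<^sub>C U x (Suc n)" for n
      using z0 by (auto intro!: ell2_eqI simp: U_def TC)
    have sz: "summable (\<lambda>n. z *\<^sub>C U x n)"
      by (rule bounded_linear.summable[OF bounded_linear_scaleC_ell2 sU])
    have "T (suminf (U x)) = (\<Sum>n. z *\<^sub>C U x (Suc n))"
      using T.suminf[OF sU[of x]] by (simp add: step)
    also have "\<dots> = (\<Sum>n. z *\<^sub>C U x n) - z *\<^sub>C U x 0"
      by (rule suminf_split_head[OF sz])
    also have "(\<Sum>n. z *\<^sub>C U x n) = z *\<^sub>C suminf (U x)"
      using bounded_linear.suminf[OF bounded_linear_scaleC_ell2[of z] sU[of x]] by simp
    also have "z *\<^sub>C U x 0 = x"
      using z0 by (intro ell2_eqI) (simp add: U_def)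
    finally show ?thesis by simp
  qed
  have inj: "inj (\<lambda>x. z *\<^sub>C x - T x)"
  proof (rule injI)
    fix x y assume "z *\<^sub>C x - T x = z *\<^sub>C y - T y"
    moreover have "z *\<^sub>C (x - y) - T (x - y) = (z *\<^sub>C x - T x) - (z *\<^sub>C y - T y)"
      unfolding linear_diff[OF bounded_linear.linear[OF bounded_linear_scaleC_ell2]] T.diff
      by (simp only: diff_diff_eq2 diff_diff_eq add_diff_eq diff_add_eq add_ac)
    ultimately have "z *\<^sub>C (x - y) - T (x - y) = 0" by simp
    then have "norm (z *\<^sub>C (x - y)) = norm (T (x - y))" by simp
    then have "cmod z * norm (x - y) \<le> onorm T * norm (x - y)"
      using onorm[OF T, of "x - y"] by simp
    then have "norm (x - y) \<le> 0" using z by (simp add: mult_le_cancel_right)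
    then show "x = y" by simp
  qed
  show "bij (\<lambda>x. z *\<^sub>C x - T x)"
    by (rule bijI[OF inj surjI[where f = "\<lambda>x. suminf (U x)"]]) (rule right)
  have "resolvent T z x = suminf (U x)"
    unfolding resolvent_def by (rule inv_f_eq[OF inj right])
  then show "(\<lambda>n. inverse (z ^ Suc n) *\<^sub>C (T ^^ n) x) sums resolvent T z x"
    using summable_sums[OF sU[of x]] by (simp add: U_def[abs_def])
qed

lemma integral0_eqI:
  assumes "X 0 = 0" "\<And>t. (X has_vector_derivative f t) (at t)"
  shows "integral0 f = X"
  unfolding integral0_def
proof (rule the_equality)
  show "X 0 = 0 \<and> (\<forall>t. (X has_vector_derivative f t) (at t))" using assms by blast
next
  fix Y assume Y: "Y 0 = 0 \<and> (\<forall>t. (Y has_vector_derivative f t) (at t))"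
  have "((\<lambda>t. Y t - X t) has_vector_derivative 0) (at t within UNIV)" for t
    using has_vector_derivative_diff[of Y "f t" "at t" X "f t"] Y assms(2) by simp
  then obtain k where "\<And>t. Y t - X t = k"
    using has_vector_derivative_zero_constant[of UNIV "\<lambda>t. Y t - X t"] by auto
  from this[of 0] this have "Y t = X t" for t using Y assms(1) by simp
  then show "Y = X" by (rule ext)
qed

lemma
  fixes f :: "real \<Rightarrow> 'a::euclidean_space"
  assumes "continuous_on UNIV f"
  shows integral0_0: "integral0 f 0 = 0"
    and has_vector_derivative_integral0: "(integral0 f has_vector_derivative f t) (at t)"
proof -
  have "\<exists>F. \<forall>x :: real. -\<infinity> < ereal x \<longrightarrow> ereal x < \<infinity> \<longrightarrow> (F has_vector_derivative f x) (at x)"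
    by (rule einterval_antiderivative)
      (use assms in \<open>auto simp: continuous_on_eq_continuous_at\<close>)
  then obtain F where F: "\<And>x. (F has_vector_derivative f x) (at x)" by auto
  have D: "((\<lambda>x. F x - F 0) has_vector_derivative f x) (at x)" for x
    using has_vector_derivative_diff[OF F has_vector_derivative_const] by simp
  have "integral0 f = (\<lambda>x. F x - F 0)"
    by (rule integral0_eqI) (use D in auto)
  then show "integral0 f 0 = 0" "(integral0 f has_vector_derivative f t) (at t)"
    using D by auto
qed

end

theory Submission
  imports Defs
begin

text \<open>
  Let \<open>S\<^sub>n\<close> be the upper left block of \<open>J\<^sup>n\<close>. The lattice equations are a Lax equation for \<open>J\<close>, and
  conjugation turns the resulting evolution of \<open>S\<^sub>n\<close> into a shift: \<open>T\<^sub>n = C\<^sub>0\<^sup>-\<^sup>1 S\<^sub>n N\<close> satisfies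
  \<open>T\<^sub>n' = T\<^sub>n\<^sub>+\<^sub>1\<close> and \<open>T\<^sub>0 = C\<^sub>0\<^sup>-\<^sup>1 N\<close>. The generating function \<open>\<Sum>n. T\<^sub>n / z ^ (n + 1)\<close> is the
  conjugated resolvent block and solves a scalar linear differential equation, whose solution is
  the asserted formula. For times \<open>s\<close> strictly between 0 and \<open>t\<close> nothing is assumed about \<open>\<parallel>J(s)\<parallel>\<close>; but
  \<open>T\<^sub>n(s)\<close> is given by its Taylor series at 0, so that \<open>\<parallel>T\<^sub>n(s)\<parallel>\<close> still grows at most like \<open>\<parallel>J(0)\<parallel>\<^sup>n\<close>,
  and the series converges for \<open>|z| > \<parallel>J(0)\<parallel>\<close>.
\<close>

subsection \<open>Sequences of functions with \<open>g\<^sub>n' = g\<^sub>n\<^sub>+\<^sub>1\<close>\<close>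

lemma has_vector_derivative_imp_continuous_on_UNIV:
  assumes "\<And>t. (f has_vector_derivative f' t) (at t)"
  shows "continuous_on UNIV f"
  using has_vector_derivative_continuous[OF assms]
  by (simp add: continuous_on_eq_continuous_at)

lemma has_vector_derivative_exp_comp:
  fixes f :: "real \<Rightarrow> complex"
  assumes "(f has_vector_derivative d) (at t)"
  shows "((\<lambda>t. exp (f t)) has_vector_derivative exp (f t) * d) (at t)"
  using field_vector_diff_chain_at[OF assms DERIV_exp] by (simp add: o_def mult.commute)

text \<open>The Lagrange remainder is at most \<open>C\<close> times the term of index
  \<open>N\<close> of the series of \<open>exp (k * \<bar>s\<bar>)\<close>, hence tends to
  0.\<close>

lemma Maclaurin_sums_real:
  fixes g :: "nat \<Rightarrow> real \<Rightarrow> real"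
  assumes der: "\<And>n t. (g n has_real_derivative g (Suc n) t) (at t)"
    and bd: "\<And>n t. \<bar>t\<bar> \<le> \<bar>s\<bar> \<Longrightarrow> \<bar>g n t\<bar> \<le> C * k ^ n"
  shows "(\<lambda>m. g m 0 / fact m * s ^ m) sums g 0 s"
  unfolding sums_def
proof (rule Lim_transform2[OF tendsto_const])
  have lim: "(\<lambda>N. C * ((k * \<bar>s\<bar>) ^ N /\<^sub>R fact N)) \<longlonglongrightarrow> 0"
    by (intro tendsto_mult_right_zero summable_LIMSEQ_zero summable_exp_generic)
  have le: "norm (g 0 s - (\<Sum>m<N. g m 0 / fact m * s ^ m))
      \<le> C * ((k * \<bar>s\<bar>) ^ N /\<^sub>R fact N)" for N
  proof -
    obtain u where u: "\<bar>u\<bar> \<le> \<bar>s\<bar>"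
      "g 0 s = (\<Sum>m<N. g m 0 / fact m * s ^ m) + g N u / fact N * s ^ N"
      using Maclaurin_all_le[of g "g 0" s N] der by auto
    have "norm (g 0 s - (\<Sum>m<N. g m 0 / fact m * s ^ m)) = \<bar>g N u\<bar> * (\<bar>s\<bar> ^ N / fact N)"
      using u(2) by (simp add: abs_mult power_abs)
    also have "\<dots> \<le> C * k ^ N * (\<bar>s\<bar> ^ N / fact N)"
      by (intro mult_right_mono bd u(1)) simp
    finally show ?thesis by (simp add: power_mult_distrib divide_inverse mult_ac)
  qed
  show "(\<lambda>N. g 0 s - (\<Sum>m<N. g m 0 / fact m * s ^ m)) \<longlonglongrightarrow> 0"
    by (rule Lim_null_comparison[OF always_eventually[OF allI[OF le]] lim])
qed

text \<open>The Lagrange remainder is a real-valued device, so real and imaginary parts are treated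
  separately.\<close>

lemma Maclaurin_sums_complex:
  fixes g :: "nat \<Rightarrow> real \<Rightarrow> complex"
  assumes der: "\<And>n t. (g n has_vector_derivative g (Suc n) t) (at t)"
    and bd: "\<And>n t. \<bar>t\<bar> \<le> \<bar>s\<bar> \<Longrightarrow> cmod (g n t) \<le> C * k ^ n"
  shows "(\<lambda>m. g m 0 / fact m * of_real s ^ m) sums g 0 s"
proof -
  have "(\<lambda>m. Re (g m 0) / fact m * s ^ m) sums Re (g 0 s)"
    by (rule Maclaurin_sums_real[where g = "\<lambda>n t. Re (g n t)" and C = C and k = k])
      (use der bd in \<open>auto simp: has_vector_derivative_complex_iff
        intro: order_trans[OF abs_Re_le_cmod]\<close>)
  moreover have "(\<lambda>m. Im (g m 0) / fact m * s ^ m) sums Im (g 0 s)"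
    by (rule Maclaurin_sums_real[where g = "\<lambda>n t. Im (g n t)" and C = C and k = k])
      (use der bd in \<open>auto simp: has_vector_derivative_complex_iff
        intro: order_trans[OF abs_Im_le_cmod]\<close>)
  moreover have "g m 0 / fact m * of_real s ^ m = (s ^ m / fact m) *\<^sub>R g m 0" for m
    by (simp add: scaleR_conv_of_real)
  ultimately show ?thesis unfolding sums_complex_iff by (simp add: mult.commute)
qed

text \<open>The crude rate \<open>k\<close> only makes the Taylor series converge. Once it does, the
  values at 0 alone determine the growth, and the rate improves to \<open>R\<close>.\<close>

lemma derivative_tower_growth:
  fixes g :: "nat \<Rightarrow> real \<Rightarrow> complex"
  assumes der: "\<And>n t. (g n has_vector_derivative g (Suc n) t) (at t)"
    and bd: "\<And>n t. \<bar>t\<bar> \<le> \<bar>s\<bar> \<Longrightarrow> cmod (g n t) \<le> C * k ^ n"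
    and g0: "\<And>n. cmod (g n 0) \<le> A * R ^ n"
  shows "cmod (g n s) \<le> A * exp (R * \<bar>s\<bar>) * R ^ n"
proof -
  \<comment> \<open>The tower starting at \<open>n\<close> is again a tower, with
    \<open>C * k ^ n\<close> in place of \<open>C\<close>.\<close>
  have "(\<lambda>m. g (m + n) 0 / fact m * of_real s ^ m) sums g (0 + n) s"
    by (rule Maclaurin_sums_complex[where g = "\<lambda>m. g (m + n)" and C = "C * k ^ n" and k = k])
      (use der bd[of _ "_ + n"] in \<open>auto simp: power_add mult_ac\<close>)
  moreover have "(\<lambda>m. A * R ^ n * ((R * \<bar>s\<bar>) ^ m /\<^sub>R fact m)) sums (A * R ^ n * exp (R * \<bar>s\<bar>))"
    by (intro sums_mult exp_converges)
  moreover have "cmod (g (m + n) 0 / fact m * of_real s ^ m)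
      \<le> A * R ^ n * ((R * \<bar>s\<bar>) ^ m /\<^sub>R fact m)" for m
  proof -
    have "cmod (g (m + n) 0 / fact m * of_real s ^ m) = cmod (g (m + n) 0) * (\<bar>s\<bar> ^ m / fact m)"
      by (simp add: norm_mult norm_divide norm_power)
    also have "\<dots> \<le> A * R ^ (m + n) * (\<bar>s\<bar> ^ m / fact m)"
      by (intro mult_right_mono g0) simp
    finally show ?thesis by (simp add: power_mult_distrib power_add divide_inverse mult_ac)
  qed
  ultimately have "cmod (g (0 + n) s) \<le> A * R ^ n * exp (R * \<bar>s\<bar>)"
    by (rule norm_sums_le)
  then show ?thesis by (simp add: mult_ac)
qed

text \<open>
  The formula says that \<open>exp (- z * t) * (\<Sum>n. g n t / z ^ Suc n)\<close> has derivative
  \<open>- exp (- z * t) * g 0 t\<close>. Truncating the series after \<open>N\<close> terms changes this derivative by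
  \<open>exp (- z * t) * g N t / z ^ N\<close>, which tends to 0 uniformly on compact intervals.
\<close>

lemma derivative_tower_generating_function:
  fixes g :: "nat \<Rightarrow> real \<Rightarrow> complex"
  assumes der: "\<And>n t. (g n has_vector_derivative g (Suc n) t) (at t)"
    and bd: "\<And>n s. \<bar>s\<bar> \<le> \<bar>t\<bar> \<Longrightarrow> cmod (g n s) \<le> C * k ^ n"
    and g0: "\<And>n. cmod (g n 0) \<le> A * R ^ n"
    and R: "0 \<le> R" "R < cmod z"
    and L: "(\<lambda>n. g n t / z ^ Suc n) sums L" "(\<lambda>n. g n 0 / z ^ Suc n) sums L0"
  shows "L = exp (z * of_real t) * (- integral0 (\<lambda>s. exp (- z * of_real s) * g 0 s) t + L0)"
proof -
  have z: "z \<noteq> 0" using R by auto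
  define I where "I = integral0 (\<lambda>s. exp (- z * of_real s) * g 0 s)"
  have ex: "((\<lambda>s. exp (- z * of_real s)) has_vector_derivative - z * exp (- z * of_real s)) (at s)" for s
    by (rule has_vector_derivative_eq_rhs[OF has_vector_derivative_exp_comp])
      (auto intro!: derivative_eq_intros)
  have cont: "continuous_on UNIV (\<lambda>s. exp (- z * of_real s) * g 0 s)"
    by (intro continuous_intros has_vector_derivative_imp_continuous_on_UNIV[OF der])
  note I0 = integral0_0[OF cont, folded I_def]
  note ID = has_vector_derivative_integral0[OF cont, folded I_def]
  define E where "E N s = exp (- z * of_real s) * (\<Sum>n<N. g n s / z ^ Suc n) + I s" for N s
  have ED: "(E N has_vector_derivative exp (- z * of_real s) * (g N s / z ^ N)) (at s)" for N s
  proof -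
    define S S' where "S = (\<Sum>n<N. g n s / z ^ Suc n)"
      and "S' = (\<Sum>n<N. g (Suc n) s / z ^ Suc n)"
    \<comment> \<open>\<open>S'\<close> and \<open>z * S\<close> have the same terms up to an index
      shift; only the first and the last survive.\<close>
    have tele: "S' - z * S + g 0 s = g N s / z ^ N"
      unfolding S_def S'_def
    proof (induction N)
      case (Suc N)
      have "z * (g N s / z ^ Suc N) = g N s / z ^ N" using z by simp
      then show ?case using Suc.IH unfolding sum.lessThan_Suc by algebra
    qed simp
    have "(E N has_vector_derivative exp (- z * of_real s) * S' + - z * exp (- z * of_real s) * S
        + exp (- z * of_real s) * g 0 s) (at s)"
      unfolding E_def[abs_def] S_def S'_def
      by (rule has_vector_derivative_add[OF has_vector_derivative_mult[OF ex
            has_vector_derivative_sum[OF has_vector_derivative_divide[OF der]]] ID])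
    then show ?thesis unfolding tele[symmetric]
      by (rule has_vector_derivative_eq_rhs) algebra
  qed
  \<comment> \<open>The first factor bounds the exponential, the second comes from
    \<open>derivative_tower_growth\<close>; \<open>\<bar>A\<bar>\<close> makes it monotone in
    \<open>\<bar>s\<bar>\<close> without a look at the sign of \<open>A\<close>.\<close>
  define B where "B = exp (cmod z * \<bar>t\<bar>) * (\<bar>A\<bar> * exp (R * \<bar>t\<bar>))"
  have "norm (E N t - E N 0) \<le> B * (R / cmod z) ^ N * norm (t - 0)" for N
  \<comment> \<open>A symmetric interval contains 0 and \<open>t\<close> for either sign of
    \<open>t\<close>.\<close>
  proof (rule differentiable_bound[where S = "{-\<bar>t\<bar>..\<bar>t\<bar>}"])
    fix s assume s: "s \<in> {-\<bar>t\<bar>..\<bar>t\<bar>}"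
    then have s': "\<bar>s\<bar> \<le> \<bar>t\<bar>" by auto
    show "(E N has_derivative (\<lambda>x. x *\<^sub>R (exp (- z * of_real s) * (g N s / z ^ N))))
        (at s within {-\<bar>t\<bar>..\<bar>t\<bar>})"
      using has_vector_derivative_at_within[OF ED] by (simp only: has_vector_derivative_def)
    have "cmod (exp (- z * of_real s)) \<le> exp (cmod z * \<bar>t\<bar>)"
      by (rule order_trans[OF norm_exp]) (use s' in \<open>auto simp: norm_mult mult_left_mono\<close>)
    moreover have "cmod (g N s) \<le> \<bar>A\<bar> * exp (R * \<bar>t\<bar>) * R ^ N"
    proof -
      have "cmod (g N s) \<le> A * exp (R * \<bar>s\<bar>) * R ^ N"
        by (rule derivative_tower_growth[OF der bd g0]) (use s' in auto)
      also have "\<dots> \<le> \<bar>A\<bar> * exp (R * \<bar>t\<bar>) * R ^ N"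
        using s' R(1) by (intro mult_right_mono mult_mono) (auto simp: mult_left_mono)
      finally show ?thesis .
    qed
    ultimately have "cmod (exp (- z * of_real s) * (g N s / z ^ N)) \<le>
        exp (cmod z * \<bar>t\<bar>) * (\<bar>A\<bar> * exp (R * \<bar>t\<bar>) * R ^ N / cmod z ^ N)"
      unfolding norm_mult[of "exp _"] norm_divide norm_power
      by (intro mult_mono divide_right_mono) auto
    then have le: "cmod (exp (- z * of_real s) * (g N s / z ^ N)) \<le> B * (R / cmod z) ^ N"
      by (simp add: B_def power_divide mult_ac)
    show "onorm (\<lambda>x. x *\<^sub>R (exp (- z * of_real s) * (g N s / z ^ N))) \<le> B * (R / cmod z) ^ N"
    proof (rule onorm_le)
      fix x :: real
      show "norm (x *\<^sub>R (exp (- z * of_real s) * (g N s / z ^ N))) \<le> B * (R / cmod z) ^ N * norm x"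
        unfolding norm_scaleR real_norm_def by (subst mult.commute) (intro mult_right_mono le abs_ge_zero)
    qed
  qed auto
  then have le: "norm (E N t - E N 0) \<le> B * (R / cmod z) ^ N * norm t" for N by simp
  have "(\<lambda>N. B * (R / cmod z) ^ N * norm t) \<longlonglongrightarrow> B * 0 * norm t"
    using R z by (intro tendsto_intros LIMSEQ_power_zero) (auto simp: divide_less_eq)
  then have "(\<lambda>N. B * (R / cmod z) ^ N * norm t) \<longlonglongrightarrow> 0"
    by (simp only: mult_zero_left mult_zero_right)
  then have "(\<lambda>N. E N t - E N 0) \<longlonglongrightarrow> 0"
    by (rule Lim_null_comparison[OF always_eventually[OF allI[OF le]]])
  moreover have "(\<lambda>N. E N t - E N 0) \<longlonglongrightarrow> (exp (- z * of_real t) * L + I t) - L0"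
    unfolding E_def I0 using tendsto_diff[OF tendsto_add[OF tendsto_mult[OF tendsto_const
      L(1)[unfolded sums_def]] tendsto_const] L(2)[unfolded sums_def]] by simp
  ultimately have "exp (- z * of_real t) * L + I t - L0 = 0"
    using LIMSEQ_unique by blast
  then have "exp (- z * of_real t) * L = - I t + L0" by (simp add: algebra_simps)
  then have "exp (z * of_real t) * (exp (- z * of_real t) * L) = exp (z * of_real t) * (- I t + L0)"
    by simp
  then show ?thesis by (simp add: I_def mult.assoc[symmetric] exp_add[symmetric])
qed

text \<open>Each entry of the matrix solution solves the scalar problem, whose solution is unique.
  This reduces the matrix formula to its entries.\<close>

lemma integral0_component:
  fixes f :: "real \<Rightarrow> 'a::euclidean_space^'n::finite^'m::finite"
  assumes "continuous_on UNIV f"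
  shows "integral0 f t $ i $ j = integral0 (\<lambda>s. f s $ i $ j) t"
proof -
  have "integral0 (\<lambda>s. f s $ i $ j) = (\<lambda>t. integral0 f t $ i $ j)"
    using integral0_0[OF assms] has_vector_derivative_integral0[OF assms]
    by (intro integral0_eqI bounded_linear.has_vector_derivative[OF bounded_linear_compose[OF
        bounded_linear_vec_nth bounded_linear_vec_nth]]) auto
  then show ?thesis by simp
qed

subsection \<open>Blocks and \<open>2 \<times> 2\<close> matrices\<close>

lemma matrix_inv_right_left:
  fixes A :: "'a::field^'n^'n"
  assumes "invertible A"
  shows "A ** matrix_inv A = mat 1" "matrix_inv A ** A = mat 1"
  using someI_ex[OF assms[unfolded invertible_def]] by (auto simp: matrix_inv_def)

text \<open>Only an inequality, because \<open>unit_ell2 0\<close> is the zero vector.\<close>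

lemma norm_unit_ell2_le: "norm (unit_ell2 j) \<le> 1"
proof -
  have "(norm (unit_ell2 j))\<^sup>2 = (\<Sum>n\<in>{j}. (cmod (ell2_nth (unit_ell2 j) n))\<^sup>2)"
    unfolding norm_ell2_square by (rule suminf_finite) (auto simp: ell2_nth_unit)
  also have "\<dots> \<le> 1\<^sup>2" by (simp add: ell2_nth_unit)
  finally show ?thesis by (rule power2_le_imp_le) simp
qed

lemma norm_funpow_le_onorm:
  fixes T :: "'a::real_normed_vector \<Rightarrow> 'a"
  assumes "bounded_linear T"
  shows "norm ((T ^^ n) x) \<le> onorm T ^ n * norm x"
proof (induction n)
  case (Suc n)
  have "norm ((T ^^ Suc n) x) \<le> onorm T * norm ((T ^^ n) x)"
    using onorm[OF assms, of "(T ^^ n) x"] by simp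
  also have "\<dots> \<le> onorm T * (onorm T ^ n * norm x)"
    by (intro mult_left_mono Suc onorm_pos_le assms)
  finally show ?case by (simp add: mult.assoc)
qed simp

lemma norm_upper_left_block_funpow_le:
  assumes "bounded_linear T"
  shows "cmod (upper_left_block (T ^^ n) $ k $ l) \<le> onorm T ^ n"
proof -
  have "cmod (ell2_nth ((T ^^ n) (unit_ell2 j)) i) \<le> onorm T ^ n" for i j
  proof -
    have "cmod (ell2_nth ((T ^^ n) (unit_ell2 j)) i) \<le> onorm T ^ n * norm (unit_ell2 j)"
      by (rule order_trans[OF norm_ell2_nth_le norm_funpow_le_onorm[OF assms]])
    also have "\<dots> \<le> onorm T ^ n"
      by (rule mult_left_le[OF norm_unit_ell2_le]) (simp add: onorm_pos_le assms)
    finally show ?thesis .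
  qed
  then show ?thesis
    using exhaust_2[of k] exhaust_2[of l] by (auto simp: upper_left_block_def)
qed

lemma upper_left_block_resolvent_sums:
  assumes "bounded_linear T" "\<And>w x. T (w *\<^sub>C x) = w *\<^sub>C T x" "onorm T < cmod z"
  shows "(\<lambda>n. upper_left_block (T ^^ n) $ k $ l / z ^ Suc n) sums
    upper_left_block (resolvent T z) $ k $ l"
proof -
  have "(\<lambda>n. ell2_nth ((T ^^ n) x) i / z ^ Suc n) sums ell2_nth (resolvent T z x) i" for x i
    using bounded_linear.sums[OF bounded_linear_ell2_nth resolvent_sums(2)[OF assms]]
    by (simp add: divide_inverse mult.commute)
  then show ?thesis
    using exhaust_2[of k] exhaust_2[of l] by (auto simp: upper_left_block_def simp del: power_Suc)
qed

lemma norm_matrix_mult3_le: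
  fixes A B C :: "complex^'n::finite^'n"
  assumes "\<And>k l. cmod (B $ k $ l) \<le> \<beta>"
  shows "cmod ((A ** B ** C) $ i $ j) \<le> (\<Sum>l\<in>UNIV. \<Sum>k\<in>UNIV. cmod (A $ i $ k) * cmod (C $ l $ j)) * \<beta>"
  unfolding matrix_matrix_mult_def vec_lambda_beta sum_distrib_right
proof (intro sum_norm_le)
  fix k l
  have "cmod (A $ i $ k * B $ k $ l * C $ l $ j) =
      cmod (A $ i $ k) * cmod (C $ l $ j) * cmod (B $ k $ l)"
    by (simp add: norm_mult)
  also have "\<dots> \<le> cmod (A $ i $ k) * cmod (C $ l $ j) * \<beta>"
    by (intro mult_left_mono assms) simp
  finally show "cmod (A $ i $ k * B $ k $ l * C $ l $ j) \<le> cmod (A $ i $ k) * cmod (C $ l $ j) * \<beta>" .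
qed

lemma matrix_mult3_sums:
  fixes A B C :: "'a::real_normed_field^'n::finite^'n"
  assumes "\<And>k l. (\<lambda>n. X n $ k $ l / w n) sums (B $ k $ l)"
  shows "(\<lambda>n. (A ** X n ** C) $ i $ j / w n) sums ((A ** B ** C) $ i $ j)"
proof -
  have "(\<lambda>n. \<Sum>l\<in>UNIV. \<Sum>k\<in>UNIV. A $ i $ k * C $ l $ j * (X n $ k $ l / w n)) sums
      (\<Sum>l\<in>UNIV. \<Sum>k\<in>UNIV. A $ i $ k * C $ l $ j * B $ k $ l)"
    by (intro sums_sum sums_mult assms)
  then show ?thesis
    by (simp add: matrix_matrix_mult_def sum_distrib_left sum_distrib_right sum_divide_distrib mult_ac)
qed

lemma scaleC_mat_nth [simp]: "(k *\<^sub>M A) $ i $ j = k * A $ i $ j"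
  by (simp add: scaleC_mat_def)

lemma matrix_mult3_scaleC: "A ** (k *\<^sub>M B) ** C = k *\<^sub>M (A ** B ** C)"
  by (simp add: vec_eq_iff matrix_matrix_mult_def sum_distrib_left sum_distrib_right mult_ac)

lemma invertible_C0_mat: "invertible (C0_mat a t)"
  by (simp add: invertible_det_nz det_2 C0_mat_def)

lemma invertible_N_mat: "invertible (N_mat a t)"
  by (simp add: invertible_det_nz det_2 N_mat_def)

lemma matrix_inv_C0_mat: "matrix_inv (C0_mat a t) = vector [vector [1, 0], vector [a 1 t, 1]]"
  (is "_ = ?B")
proof -
  have "?B = ?B ** (C0_mat a t ** matrix_inv (C0_mat a t))"
    by (simp add: matrix_inv_right_left invertible_C0_mat)
  also have "\<dots> = (?B ** C0_mat a t) ** matrix_inv (C0_mat a t)"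
    by (simp only: matrix_mul_assoc)
  also have "?B ** C0_mat a t = mat 1"
    by (simp add: vec_eq_iff forall_2 matrix_matrix_mult_def sum_2 C0_mat_def mat_def)
  finally show ?thesis by simp
qed

subsection \<open>The flow\<close>

locale lattice_flow =
  fixes a b c :: "nat \<Rightarrow> real \<Rightarrow> complex" and K :: real
  assumes bounded: "\<And>n t. n \<ge> 1 \<Longrightarrow> cmod (a n t) \<le> K \<and> cmod (b n t) \<le> K \<and> cmod (c n t) \<le> K"
    and b_0: "\<And>t. b 0 t = 0"
    and c_0: "\<And>t. c 0 t = 0"
    and a_eq: "\<And>n t. n \<ge> 1 \<Longrightarrow>
      (a n has_vector_derivative b n t - b (n - 1) t) (at t)"
    and b_eq: "\<And>n t. n \<ge> 1 \<Longrightarrow>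
      (b n has_vector_derivative
        b n t * (a (n + 1) t - a n t) + c n t - c (n - 1) t) (at t)"
    and c_eq: "\<And>n t. n \<ge> 1 \<Longrightarrow>
      (c n has_vector_derivative c n t * (a (n + 2) t - a n t)) (at t)"
begin

lemma bounded_linear_J: "bounded_linear (J_op a b c t)"
  by (rule bounded_linear_J_op) (rule bounded)

lemma J_scaleC: "J_op a b c t (w *\<^sub>C x) = w *\<^sub>C J_op a b c t x"
  by (rule J_op_scaleC) (rule bounded)

lemma ell2_nth_J: "ell2_nth (J_op a b c t x) m =
    (\<Sum>n. J_matrix (\<lambda>n. a n t) (\<lambda>n. b n t) (\<lambda>n. c n t) m n * ell2_nth x n)"
  by (rule ell2_nth_J_op) (rule bounded)

section \<open>Entries of the powers of \<open>J\<close> and their evolution\<close>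

definition moment :: "nat \<Rightarrow> nat \<Rightarrow> nat \<Rightarrow> real \<Rightarrow> complex"
  where "moment n i j t = ell2_nth ((J_op a b c t ^^ n) (unit_ell2 j)) i"

lemma moment_0_row [simp]: "moment n 0 j t = 0"
  by (simp add: moment_def)

lemma moment_0_col: "moment n i 0 t = 0"
proof -
  have "unit_ell2 0 = 0" by (intro ell2_eqI) (simp add: ell2_nth_unit)
  moreover have "J_op a b c t 0 = 0"
    by (rule linear_0[OF bounded_linear.linear[OF bounded_linear_J]])
  then have "(J_op a b c t ^^ n) 0 = 0" by (induction n) simp_all
  ultimately show ?thesis by (simp add: moment_def)
qed

text \<open>This is row \<open>i\<close> of \<open>J\<close> applied to \<open>J ^ n\<close>. For
  \<open>i \<le> 2\<close> truncated subtraction lands in the padding row 0, where the moments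
  vanish.\<close>

lemma moment_Suc:
  assumes "i \<ge> 1"
  shows "moment (Suc n) i j t = a i t * moment n i j t + moment n (i + 1) j t
    + b (i - 1) t * moment n (i - 1) j t + c (i - 2) t * moment n (i - 2) j t"
proof -
  have "i \<noteq> 0" using assms by simp
  from J_row[OF this] show ?thesis
    by (simp only: moment_def funpow.simps o_apply ell2_nth_J)
qed

lemma onorm_J_op_le: "onorm (J_op a b c t) \<le> 4 * (1 + K)"
proof (rule onorm_bound)
  have K: "0 \<le> K"
    by (rule order_trans[OF norm_ge_zero conjunct1[OF bounded[OF order_refl]]])
  then show "0 \<le> 4 * (1 + K)" by simp
  fix x
  have "(norm (J_op a b c t x))\<^sup>2 \<le> (4 * (1 + K) * norm x)\<^sup>2"
    unfolding norm_ell2_square[of "J_op a b c t x"] ell2_nth_J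
    by (intro J_matrix_bounded(3) bounded)
  then show "norm (J_op a b c t x) \<le> 4 * (1 + K) * norm x"
    by (rule power2_le_imp_le) (use K in simp)
qed

text \<open>
  With \<open>J\<^sub>-\<close> the strictly lower triangular part of \<open>J\<close>, the equations say \<open>J' = J J\<^sub>- - J\<^sub>- J\<close>, so
  \<open>(J\<^sup>n)' = J\<^sup>n J\<^sub>- - J\<^sub>- J\<^sup>n\<close>. Column \<open>j\<close> of \<open>J\<^sub>-\<close> is \<open>J e\<^sub>j - a\<^sub>j e\<^sub>j - e\<^sub>j\<^sub>-\<^sub>1\<close>,
  which keeps the right-hand side within columns \<open>j - 1\<close> and \<open>j\<close>.
\<close>

lemma moment_has_vector_derivative:
  assumes "i \<ge> 1" "j \<ge> 1"
  shows "(moment n i j has_vector_derivative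
    moment (Suc n) i j t - a j t * moment n i j t - moment n i (j - 1) t
      - (b (i - 1) t * moment n (i - 1) j t + c (i - 2) t * moment n (i - 2) j t)) (at t)"
proof -
  let ?d = "\<lambda>n i. moment (Suc n) i j t - a j t * moment n i j t - moment n i (j - 1) t
      - (b (i - 1) t * moment n (i - 1) j t + c (i - 2) t * moment n (i - 2) j t)"
  have zero: "b 0 = (\<lambda>t. 0)" "c 0 = (\<lambda>t. 0)" "moment n 0 j = (\<lambda>t. 0)" for n
    by (simp_all add: fun_eq_iff b_0 c_0)
  \<comment> \<open>The indices \<open>i - 1\<close> and \<open>i - 2\<close> may be 0, so the
    equations are extended to \<open>p = 0\<close>, where both sides vanish.\<close>
  have b: "(b p has_vector_derivative b p t * (a (p + 1) t - a p t) + c p t - c (p - 1) t) (at t)"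
    and c: "(c p has_vector_derivative c p t * (a (p + 2) t - a p t)) (at t)" for p
    using b_eq[of p t] c_eq[of p t] by (cases "p = 0"; simp add: zero)+
  have "(moment n i j has_vector_derivative ?d n i) (at t)" for i
  proof (induction n arbitrary: i)
    case 0
    have [simp]: "moment 0 p q s = (if p = q \<and> q \<noteq> 0 then 1 else 0)" for p q s
      by (simp add: moment_def ell2_nth_unit)
    \<comment> \<open>The identity commutes with \<open>J\<^sub>-\<close>.\<close>
    have "?d 0 i = 0"
      using assms(2) by (cases "i = 0") (auto simp: moment_Suc)
    moreover have "moment 0 i j = (\<lambda>t. if i = j \<and> j \<noteq> 0 then 1 else 0)" by (rule ext) simp
    ultimately show ?case by simp
  next
    case (Suc n)
    show ?case
    proof (cases "i = 0")
      case True
      then show ?thesis by (simp add: zero)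
    next
      case False
      \<comment> \<open>The left side is the product rule applied to \<open>moment_Suc\<close>, with
        the lattice equations and the induction hypothesis inserted. Indices reach down to
        \<open>i - 4\<close>, so rows 1 to 3, where subtraction truncates, are checked
        separately.\<close>
      have eq: "a i t * ?d n i + (b i t - b (i - 1) t) * moment n i j t + ?d n (i + 1)
          + (b (i - 1) t * ?d n (i - 1)
            + (b (i - 1) t * (a (i - 1 + 1) t - a (i - 1) t) + c (i - 1) t - c (i - 1 - 1) t)
              * moment n (i - 1) j t)
          + (c (i - 2) t * ?d n (i - 2)
            + c (i - 2) t * (a (i - 2 + 2) t - a (i - 2) t) * moment n (i - 2) j t)
        = ?d (Suc n) i"
      proof -
        consider "i = 1" | "i = 2" | "i = 3" | k where "i = Suc (Suc (Suc (Suc k)))"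
          using False by (metis One_nat_def Suc_1 not0_implies_Suc numeral_3_eq_3)
        then show ?thesis
          by cases (simp_all add: moment_Suc b_0 c_0 numeral_2_eq_2 numeral_3_eq_3 algebra_simps)
      qed
      let ?F = "\<lambda>t. a i t * moment n i j t + moment n (i + 1) j t
          + b (i - 1) t * moment n (i - 1) j t + c (i - 2) t * moment n (i - 2) j t"
      have "(?F has_vector_derivative ?d (Suc n) i) (at t)"
        unfolding eq[symmetric]
        by (intro has_vector_derivative_add has_vector_derivative_mult Suc.IH a_eq b c)
          (use False in simp)
      moreover have "moment (Suc n) i j = ?F"
        using moment_Suc[of i] False by (intro ext) simp
      ultimately show ?thesis by (simp only:)
    qed
  qed
  then show ?thesis .
qed

lemma continuous_a: "n \<ge> 1 \<Longrightarrow> continuous_on UNIV (a n)"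
  by (rule has_vector_derivative_imp_continuous_on_UNIV[OF a_eq])

section \<open>Conjugation turns the evolution into a shift\<close>

definition conj_block :: "nat \<Rightarrow> real \<Rightarrow> complex^2^2"
  where "conj_block n t =
    matrix_inv (C0_mat a t) ** upper_left_block (J_op a b c t ^^ n) ** N_mat a t"

lemma conj_block_0: "conj_block 0 t = matrix_inv (C0_mat a t) ** N_mat a t"
proof -
  have "upper_left_block (J_op a b c t ^^ 0) = mat 1"
    by (simp add: upper_left_block_def ell2_nth_unit vec_eq_iff forall_2 mat_def)
  then show ?thesis by (simp add: conj_block_def)
qed

lemma N_mat_0: "N_mat a 0 = mat 1"
proof -
  have "continuous_on UNIV (\<lambda>s. exp (integral0 (\<lambda>r. a 2 r - a 1 r) s))"
    by (intro continuous_on_exp has_vector_derivative_imp_continuous_on_UNIV[OF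
          has_vector_derivative_integral0] continuous_on_diff continuous_a) simp_all
  then show ?thesis
    by (simp add: N_mat_def integral0_0 continuous_a continuous_on_diff vec_eq_iff forall_2 mat_def)
qed

text \<open>The coefficient is the leading block of \<open>J\<close> without its strictly lower
  part. The top right entry of \<open>N_mat\<close> is the variation of constants formula for this
  triangular system.\<close>

lemma N_mat_has_vector_derivative:
  "((\<lambda>t. N_mat a t $ i $ j) has_vector_derivative
    (vector [vector [a 1 t, 1], vector [0, a 2 t]] ** N_mat a t) $ i $ j) (at t)"
proof -
  define A1 A2 D where "A1 = integral0 (a 1)" and "A2 = integral0 (a 2)"
    and "D = integral0 (\<lambda>r. a 2 r - a 1 r)"
  have A: "A1 0 = 0" "A2 0 = 0"
    "(A1 has_vector_derivative a 1 t) (at t)" "(A2 has_vector_derivative a 2 t) (at t)" for t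
    by (simp_all add: A1_def A2_def integral0_0 has_vector_derivative_integral0 continuous_a)
  \<comment> \<open>By uniqueness of antiderivatives; hence \<open>exp A1 * exp D = exp A2\<close>,
    which is the forcing term from the second row.\<close>
  have D: "D = (\<lambda>t. A2 t - A1 t)"
    unfolding D_def
    by (rule integral0_eqI) (simp add: A(1,2), rule has_vector_derivative_diff[OF A(4,3)])
  have contD: "continuous_on UNIV (\<lambda>s. exp (D s))"
    unfolding D by (intro continuous_intros has_vector_derivative_imp_continuous_on_UNIV[OF A(3)]
        has_vector_derivative_imp_continuous_on_UNIV[OF A(4)])
  define G where "G = integral0 (\<lambda>s. exp (D s))"
  have G: "(G has_vector_derivative exp (D t)) (at t)"
    unfolding G_def by (rule has_vector_derivative_integral0[OF contD])
  have E: "((\<lambda>t. exp (A1 t)) has_vector_derivative exp (A1 t) * a 1 t) (at t)"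
    "((\<lambda>t. exp (A2 t)) has_vector_derivative exp (A2 t) * a 2 t) (at t)"
    by (rule has_vector_derivative_exp_comp[OF A(3)], rule has_vector_derivative_exp_comp[OF A(4)])
  have ED: "exp (A1 t) * exp (D t) = exp (A2 t)" by (simp add: D exp_add[symmetric])
  have N: "N_mat a = (\<lambda>t. vector [vector [exp (A1 t), exp (A1 t) * G t], vector [0, exp (A2 t)]])"
    by (rule ext) (simp add: N_mat_def A1_def A2_def D_def G_def)
  have "((\<lambda>t. exp (A1 t) * G t) has_vector_derivative exp (A2 t) + exp (A1 t) * a 1 t * G t) (at t)"
    using has_vector_derivative_mult[OF E(1) G] by (simp add: ED)
  then show ?thesis
    using exhaust_2[of i] exhaust_2[of j] E
    by (auto simp: N matrix_matrix_mult_def sum_2 algebra_simps)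
qed

text \<open>Rows 1 and 2 of \<open>J\<^sub>- J\<^sup>n\<close> are 0 and \<open>b 1\<close> times
  row 1 of \<open>J\<^sup>n\<close>. The factor \<open>matrix_inv C0_mat\<close> adds
  \<open>a 1\<close> times row 1 to row 2, and \<open>a 1' = b 1\<close> cancels that term. The
  remaining column terms are the product with the triangular coefficient of \<open>N_mat\<close> and
  cancel against the derivative of \<open>N_mat\<close>.\<close>

lemma conj_block_has_vector_derivative:
  "((\<lambda>t. conj_block n t $ i $ j) has_vector_derivative conj_block (Suc n) t $ i $ j) (at t)"
proof -
  \<comment> \<open>Entry \<open>(i, k)\<close> of \<open>matrix_inv C0_mat\<close> times the block,
    with \<open>k\<close> a natural number so that the vanishing column 0 can occur as
    \<open>k - 1\<close>.\<close>
  define r where "r n i k t = (if i = 1 then moment n 1 k t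
    else a 1 t * moment n 1 k t + moment n 2 k t)" for n k t and i :: 2
  have r: "(r n i k has_vector_derivative r (Suc n) i k t - a k t * r n i k t - r n i (k - 1) t) (at t)"
    if "k \<ge> 1" for k
  proof (cases "i = 1")
    case True
    have "r n i k = moment n 1 k" by (simp add: r_def True fun_eq_iff)
    then show ?thesis
      using moment_has_vector_derivative[of 1 k n t] that
      by (simp add: r_def True b_0 c_0)
  next
    case False
    have "r n i k = (\<lambda>t. a 1 t * moment n 1 k t + moment n 2 k t)" by (simp add: r_def False fun_eq_iff)
    moreover have "((\<lambda>t. a 1 t * moment n 1 k t + moment n 2 k t) has_vector_derivative
        r (Suc n) i k t - a k t * r n i k t - r n i (k - 1) t) (at t)"
      by (rule has_vector_derivative_eq_rhs, rule has_vector_derivative_add[OF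
            has_vector_derivative_mult[OF a_eq moment_has_vector_derivative]
            moment_has_vector_derivative])
        (use that False in \<open>simp_all add: r_def b_0 c_0 algebra_simps\<close>)
    ultimately show ?thesis by simp
  qed
  have C: "conj_block n t $ i $ j = r n i 1 t * N_mat a t $ 1 $ j + r n i 2 t * N_mat a t $ 2 $ j" for n t
    using exhaust_2[of i]
    by (auto simp: conj_block_def matrix_inv_C0_mat matrix_matrix_mult_def sum_2
        upper_left_block_def r_def moment_def)
  show ?thesis
    unfolding C
    by (rule has_vector_derivative_eq_rhs, rule has_vector_derivative_add[OF
          has_vector_derivative_mult[OF r N_mat_has_vector_derivative]
          has_vector_derivative_mult[OF r N_mat_has_vector_derivative]])
      (simp_all add: matrix_matrix_mult_def sum_2 r_def moment_0_col algebra_simps)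
qed

section \<open>Growth of the conjugated blocks\<close>

lemma conj_block_bound:
  "cmod (conj_block n t $ i $ j) \<le>
    (\<Sum>l\<in>UNIV. \<Sum>k\<in>UNIV. cmod (matrix_inv (C0_mat a t) $ i $ k) * cmod (N_mat a t $ l $ j))
      * onorm (J_op a b c t) ^ n"
  unfolding conj_block_def
  by (intro norm_matrix_mult3_le norm_upper_left_block_funpow_le bounded_linear_J)

text \<open>The conjugating factors are continuous, hence bounded on compact intervals, and
  \<open>4 * (1 + K)\<close> bounds the norm of \<open>J\<close> at all times. This is the crude
  rate required for the Taylor series.\<close>

lemma conj_block_bound_compact:
  "\<exists>C. \<forall>n s. \<bar>s\<bar> \<le> T \<longrightarrow> cmod (conj_block n s $ i $ j) \<le> C * (4 * (1 + K)) ^ n"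
proof -
  define G where "G s = (\<Sum>l\<in>UNIV. \<Sum>k\<in>UNIV.
    cmod (matrix_inv (C0_mat a s) $ i $ k) * cmod (N_mat a s $ l $ j))" for s
  have C0: "continuous_on UNIV (\<lambda>s. matrix_inv (C0_mat a s) $ i $ k)" for k
    using exhaust_2[of i] exhaust_2[of k]
    by (auto simp: matrix_inv_C0_mat continuous_a)
  have "continuous_on UNIV G"
    unfolding G_def[abs_def]
    by (intro continuous_on_sum continuous_on_mult continuous_on_norm C0
        has_vector_derivative_imp_continuous_on_UNIV[OF N_mat_has_vector_derivative])
  then have "compact (G ` {-T..T})"
    by (rule compact_continuous_image[OF continuous_on_subset[OF _ subset_UNIV] compact_Icc])
  from compact_imp_bounded[OF this]
  obtain C where C: "\<And>s. s \<in> {-T..T} \<Longrightarrow> norm (G s) \<le> C"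
    unfolding bounded_iff by blast
  have "cmod (conj_block n s $ i $ j) \<le> C * (4 * (1 + K)) ^ n" if "\<bar>s\<bar> \<le> T" for n s
  proof -
    have "cmod (conj_block n s $ i $ j) \<le> G s * onorm (J_op a b c s) ^ n"
      unfolding G_def by (rule conj_block_bound)
    also have "\<dots> \<le> C * (4 * (1 + K)) ^ n"
    proof (intro mult_mono power_mono onorm_J_op_le onorm_pos_le zero_le_power bounded_linear_J)
      have "norm (G s) \<le> C" using that by (intro C) auto
      then show "G s \<le> C" "0 \<le> C" using norm_ge_zero[of "G s"] by simp_all
    qed
    finally show ?thesis .
  qed
  then show ?thesis by blast
qed

section \<open>From the blocks to the resolvent formula\<close>

lemma conj_block_sums:
  assumes "onorm (J_op a b c t) < cmod z"
  shows "(\<lambda>n. conj_block n t $ i $ j / z ^ Suc n) sums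
    ((matrix_inv (C0_mat a t) ** res_block a b c t z ** N_mat a t) $ i $ j)"
  unfolding conj_block_def res_block_def
  by (intro matrix_mult3_sums upper_left_block_resolvent_sums bounded_linear_J J_scaleC assms)

text \<open>Since \<open>N_mat a 0\<close> is the identity, it may be inserted in the second
  summand, which then is the generating function of the conjugated blocks at time 0.\<close>

lemma M_mat_nth:
  "M_mat a b c t z $ i $ j =
    - integral0 (\<lambda>s. exp (- z * of_real s) * conj_block 0 s $ i $ j) t
    + (matrix_inv (C0_mat a 0) ** res_block a b c 0 z ** N_mat a 0) $ i $ j"
proof -
  have "continuous_on UNIV (\<lambda>s. \<chi> k l. (exp (- z * of_real s) *\<^sub>M conj_block 0 s) $ k $ l)"
    unfolding scaleC_mat_nth
    by (intro continuous_on_vec_lambda continuous_on_mult continuous_on_exp continuous_intros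
        has_vector_derivative_imp_continuous_on_UNIV[OF conj_block_has_vector_derivative])
  then have "continuous_on UNIV (\<lambda>s. exp (- z * of_real s) *\<^sub>M conj_block 0 s)"
    by (simp only: vec_nth_inverse)
  from integral0_component[OF this] show ?thesis
    by (simp add: M_mat_def conj_block_0 N_mat_0)
qed

lemma conjugated_resolvent_block:
  assumes "onorm (J_op a b c t) < cmod z" "onorm (J_op a b c 0) < cmod z"
  shows "matrix_inv (C0_mat a t) ** res_block a b c t z ** N_mat a t =
    exp (z * of_real t) *\<^sub>M M_mat a b c t z"
proof -
  have "(matrix_inv (C0_mat a t) ** res_block a b c t z ** N_mat a t) $ i $ j =
    (exp (z * of_real t) *\<^sub>M M_mat a b c t z) $ i $ j" for i j
  proof -
    obtain C where C: "\<And>n s. \<bar>s\<bar> \<le> \<bar>t\<bar> \<Longrightarrow> cmod (conj_block n s $ i $ j) \<le> C * (4 * (1 + K)) ^ n"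
      using conj_block_bound_compact by blast
    show ?thesis
      unfolding scaleC_mat_nth M_mat_nth
      \<comment> \<open>The crude rate is \<open>4 * (1 + K)\<close>; the rate at time 0, from
        \<open>conj_block_bound\<close>, is \<open>onorm (J_op a b c 0)\<close>, which lies below
        \<open>cmod z\<close>.\<close>
      by (rule derivative_tower_generating_function[where g = "\<lambda>n s. conj_block n s $ i $ j",
            OF conj_block_has_vector_derivative C conj_block_bound onorm_pos_le[OF bounded_linear_J]
            assms(2) conj_block_sums[OF assms(1)] conj_block_sums[OF assms(2)]])
  qed
  then show ?thesis by (simp add: vec_eq_iff)
qed

lemma resolvent_block_formula:
  assumes "onorm (J_op a b c t) < cmod z" "onorm (J_op a b c 0) < cmod z"
  shows "res_block a b c t z =
    exp (z * of_real t) *\<^sub>M (C0_mat a t ** M_mat a b c t z ** matrix_inv (N_mat a t))"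
proof -
  let ?R = "res_block a b c t z"
  have "?R = (C0_mat a t ** matrix_inv (C0_mat a t)) ** ?R ** (N_mat a t ** matrix_inv (N_mat a t))"
    by (simp add: matrix_inv_right_left invertible_C0_mat invertible_N_mat)
  also have "\<dots> = C0_mat a t ** (matrix_inv (C0_mat a t) ** ?R ** N_mat a t) ** matrix_inv (N_mat a t)"
    by (simp only: matrix_mul_assoc)
  finally show ?thesis
    by (simp only: conjugated_resolvent_block[OF assms] matrix_mult3_scaleC)
qed

end

theorem corollary1:
  fixes a b c :: "nat \<Rightarrow> real \<Rightarrow> complex"
  assumes bounded: "\<exists>K>0. \<forall>n\<ge>1. \<forall>t. cmod (a n t) \<le> K \<and> cmod (b n t) \<le> K \<and> cmod (c n t) \<le> K"
    and c_nonzero: "\<And>n t. n \<ge> 1 \<Longrightarrow> c n t \<noteq> 0"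
    and b_0: "\<And>t. b 0 t = 0"
    and c_0: "\<And>t. c 0 t = 0"
    and a_eq: "\<And>n t. n \<ge> 1 \<Longrightarrow>
      (a n has_vector_derivative b n t - b (n - 1) t) (at t)"
    and b_eq: "\<And>n t. n \<ge> 1 \<Longrightarrow>
      (b n has_vector_derivative
        b n t * (a (n + 1) t - a n t) + c n t - c (n - 1) t) (at t)"
    and c_eq: "\<And>n t. n \<ge> 1 \<Longrightarrow>
      (c n has_vector_derivative c n t * (a (n + 2) t - a n t)) (at t)"
  shows "\<forall>t z. onorm (J_op a b c t) < cmod z \<and> onorm (J_op a b c 0) < cmod z \<longrightarrow>
    res_block a b c t z =
      exp (z * of_real t) *\<^sub>M (C0_mat a t ** M_mat a b c t z ** matrix_inv (N_mat a t))"
proof -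
  obtain K where "\<forall>n\<ge>1. \<forall>t. cmod (a n t) \<le> K \<and> cmod (b n t) \<le> K \<and> cmod (c n t) \<le> K"
    using bounded by blast
  then interpret lattice_flow a b c K
    by unfold_locales (use b_0 c_0 a_eq b_eq c_eq in auto)
  show ?thesis
    using resolvent_block_formula by blast
qed

end
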